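(* Consider an $N$-player game with cost functions $f_i:\mathbb{R}^N\to\mathbb{R}$, $i\in\mathbb{N}=\{1,\dots,N\}$, and player dynamics $\dot x_i=v_i$, $\dot v_i=u_i$ with $x_i,v_i,u_i\in\mathbb{R}$. Suppose that: (1) each $f_i$ is twice continuously differentiable; (2) there is a constant $m>0$ with $(\mathbf{x}-\mathbf{y})^T(\mathcal{P}(\mathbf{x})-\mathcal{P}(\mathbf{y}))\ge m\|\mathbf{x}-\mathbf{y}\|^2$ for all $\mathbf{x},\mathbf{y}\in\mathbb{R}^N$; (3) there is a constant $h>0$ with $\sup_{\mathbf{x}\in\mathbb{R}^N}\|H(\mathbf{x})\|=h$. Let each player $i\in\mathbb{N}$ use the observer-based control $$u_i=-k_1\frac{\partial f_i(\mathbf{x})}{\partial x_i}-k_1\bar v_i,$$ $$\dot{\bar x}_i=-k_2(\bar x_i-x_i)+\bar v_i,\qquad \dot{\bar v}_i=-k_3(\bar x_i-x_i)+u_i,$$ where $k_1,k_2,k_3$ are positive constants and $$k_1>\frac{\epsilon_2\left(2\epsilon_1h+h\sqrt{N}\max_{i\in\mathbb{N}}\{l_i\}+1\right)}{\epsilon_1(2\epsilon_2-1)},$$ with $\epsilon_1,\epsilon_2$ arbitrary positive constants satisfying $\epsilon_1<\frac{2m}{h\sqrt{N}\max_{i\in\mathbb{N}}\{l_i\}+1}$ and $\epsilon_2>\frac12$. Then Nash equilibrium seeking is achieved, i.e., for every initial condition of the closed-loop system, $$\lim_{t\to\infty}\|\mathbf{x}(t)-\mathbf{x}^*\|=0,\qquad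 \lim_{t\to\infty}\|\mathbf{v}(t)\|=0,$$ where $\mathbf{x}^*$ is the Nash equilibrium of the game.
   Context: Notation: $\mathbf{x}=[x_1,\dots,x_N]^T$, $\mathbf{v}=[v_1,\dots,v_N]^T$, $\mathbf{x}_{-i}$ is $\mathbf{x}$ with the entry $x_i$ removed, and $f_i(\mathbf{x})=f_i(x_i,\mathbf{x}_{-i})$. $\|\cdot\|$ is the Euclidean norm for vectors and the induced norm for matrices. $\mathcal{P}(\mathbf{x})=\left[\frac{\partial f_1(\mathbf{x})}{\partial x_1},\dots,\frac{\partial f_N(\mathbf{x})}{\partial x_N}\right]^T$, and $H(\mathbf{x})$ is the $N\times N$ matrix whose $(i,j)$ entry is $\frac{\partial^2 f_i(\mathbf{x})}{\partial x_i\partial x_j}$. A Nash equilibrium is a profile $\mathbf{x}^*=(x_i^*,\mathbf{x}_{-i}^* )$ with $f_i(x_i^*,\mathbf{x}_{-i}^* )\le f_i(x_i,\mathbf{x}_{-i}^* )$ for all $x_i\in\mathbb{R}$, $i\in\mathbb{N}$. Under hypotheses (1)-(2) the Nash equilibrium is unique, and $\mathcal{P}(\mathbf{x}^* )=\mathbf{0}$. By (3), each $\frac{\partial f_i}{\partial x_i}$ is globally Lipschitz on $\mathbb{R}^N$; $l_i$ denotes its Lipschitz constant: $\left|\frac{\partial f_i}{\partial x_i}(\mathbf{x})-\frac{\partial f_i}{\partial x_i}(\mathbf{y})\right|\le l_i\|\mathbf{x}-\mathbf{y}\|$ for all $\mathbf{x},\mathbf{y}\in\mathbb{R}^N$. In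 the strategy, $\bar v_i\in\mathbb{R}$ is player $i$'s estimate of its own velocity $v_i$ and $\bar x_i\in\mathbb{R}$ is an auxiliary variable. *)

theory Defs
  imports "HOL-Analysis.Analysis"
begin

text \<open>The players are the elements of a finite index type, so that \<open>N = CARD('n)\<close>. A game is given by
  its cost functions \<open>f i\<close>, and an action profile is a vector in \<open>real ^ 'n\<close>.\<close>

definition replace_entry :: "real ^ 'n \<Rightarrow> 'n \<Rightarrow> real \<Rightarrow> real ^ 'n" where
  "replace_entry x i a = (\<chi> j. if j = i then a else x $ j)"

definition partial_deriv :: "'n::finite \<Rightarrow> (real ^ 'n \<Rightarrow> real) \<Rightarrow> real ^ 'n \<Rightarrow> real" where
  "partial_deriv i g x = deriv (\<lambda>a. g (replace_entry x i a)) (x $ i)"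

definition twice_continuously_differentiable :: "('a::real_normed_vector \<Rightarrow> real) \<Rightarrow> bool" where
  "twice_continuously_differentiable g \<longleftrightarrow>
     (\<exists>(g' :: 'a \<Rightarrow> 'a \<Rightarrow>\<^sub>L real) (g'' :: 'a \<Rightarrow> 'a \<Rightarrow>\<^sub>L ('a \<Rightarrow>\<^sub>L real)).
        (\<forall>x. (g has_derivative blinfun_apply (g' x)) (at x)) \<and>
        (\<forall>x. (g' has_derivative blinfun_apply (g'' x)) (at x)) \<and>
        continuous_on UNIV g'')"

definition pseudo_gradient :: "('n::finite \<Rightarrow> real ^ 'n \<Rightarrow> real) \<Rightarrow> real ^ 'n \<Rightarrow> real ^ 'n" where
  "pseudo_gradient f x = (\<chi> i. partial_deriv i (f i) x)"

text \<open>The \<open>(i, j)\<close> entry is \<open>\<partial>\<^sup>2f\<^sub>i / \<partial>x\<^sub>i \<partial>x\<^sub>j\<close>, read as \<open>\<partial>/\<partial>x\<^sub>i (\<partial>f\<^sub>i / \<partial>x\<^sub>j)\<close>. Since every \<open>f i\<close> is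
  assumed to be twice continuously differentiable, the order of differentiation is immaterial.\<close>

definition game_hessian :: "('n::finite \<Rightarrow> real ^ 'n \<Rightarrow> real) \<Rightarrow> real ^ 'n \<Rightarrow> real ^ 'n ^ 'n" where
  "game_hessian f x = (\<chi> i j. partial_deriv i (partial_deriv j (f i)) x)"

definition matrix_norm :: "real ^ 'm ^ 'n \<Rightarrow> real" where
  "matrix_norm A = onorm (\<lambda>z. A *v z)"

definition nash_equilibrium :: "('n::finite \<Rightarrow> real ^ 'n \<Rightarrow> real) \<Rightarrow> real ^ 'n \<Rightarrow> bool" where
  "nash_equilibrium f x \<longleftrightarrow> (\<forall>i a. f i x \<le> f i (replace_entry x i a))"

definition observer_control ::
  "('n::finite \<Rightarrow> real ^ 'n \<Rightarrow> real) \<Rightarrow> real \<Rightarrow> 'n \<Rightarrow> real ^ 'n \<Rightarrow> real ^ 'n \<Rightarrow> real" where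
  "observer_control f k1 i x vb = - k1 * partial_deriv i (f i) x - k1 * vb $ i"

text \<open>Trajectories on the time interval \<open>[0, \<infinity>)\<close>; \<open>xb\<close> and \<open>vb\<close> are the observer states (written with a
  bar in the mathematical notation). The values at time \<open>0\<close> are unconstrained.\<close>

definition closed_loop_solution ::
  "('n::finite \<Rightarrow> real ^ 'n \<Rightarrow> real) \<Rightarrow> real \<Rightarrow> real \<Rightarrow> real \<Rightarrow>
   (real \<Rightarrow> real ^ 'n) \<Rightarrow> (real \<Rightarrow> real ^ 'n) \<Rightarrow> (real \<Rightarrow> real ^ 'n) \<Rightarrow> (real \<Rightarrow> real ^ 'n) \<Rightarrow> bool" where
  "closed_loop_solution f k1 k2 k3 x v xb vb \<longleftrightarrow>
     (\<forall>t\<ge>0. \<forall>i. let u = observer_control f k1 i (x t) (vb t) in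
        ((\<lambda>s. x s $ i) has_real_derivative v t $ i) (at t within {0..}) \<and>
        ((\<lambda>s. v s $ i) has_real_derivative u) (at t within {0..}) \<and>
        ((\<lambda>s. xb s $ i) has_real_derivative - k2 * (xb t $ i - x t $ i) + vb t $ i)
          (at t within {0..}) \<and>
        ((\<lambda>s. vb s $ i) has_real_derivative - k3 * (xb t $ i - x t $ i) + u)
          (at t within {0..}))"

end

theory Submission
  imports Defs
begin

text \<open>
  The control law makes \<open>v\<close> follow \<open>- P x\<close>, where \<open>P\<close> is the pseudo-gradient, so that the positions
  approximately obey the gradient play \<open>x' = - P x\<close>. The proof measures the failure of this by
  \<open>z = v + P x\<close> and uses that, with the estimation errors \<open>a = xb - x\<close> and \<open>b = vb - v\<close>, the closed loop
  becomes a cascade: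
  \<open>x' = z - P x\<close>, \<open>z' = - k1 z - k1 b + H(x)(z - P x)\<close>, \<open>a' = b - k2 a\<close>, \<open>b' = - k3 a\<close>.
  The unknown input \<open>u\<close> cancels in the error equations, so the observer is an autonomous stable linear
  system that merely drives the other two equations.

  Put \<open>e = x - xs\<close> for the Nash equilibrium \<open>xs\<close>. In the derivative of \<open>(|e|\<^sup>2 + |z|\<^sup>2) / 2\<close>, strong
  monotonicity yields \<open>- m |e|\<^sup>2\<close>, the bound on the Hessian and the Lipschitz bound
  \<open>|P x| \<le> K |e|\<close> with \<open>K = sqrt N * max l\<close> bound the coupling by
  \<open>h |z|\<^sup>2 + (1 + h K) |e| |z|\<close>, and the observer contributes \<open>k1 |z| |b|\<close>. Young's inequality with weight
  \<open>\<epsilon>1\<close> for the first product and \<open>\<epsilon>2\<close> for the second turns the two gain conditions into exactly the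
  statement that the coefficients of \<open>|e|\<^sup>2\<close> and \<open>|z|\<^sup>2\<close> are negative
  (\<open>seeking_energy_dissipation\<close>, \<open>gain_conditions_imp_positive_rates\<close>). The remaining term in \<open>|b|\<^sup>2\<close> is
  absorbed by a multiple of a quadratic Lyapunov function of the observer
  (\<open>observer_energy_dissipation\<close>). The total energy \<open>W\<close> thus satisfies \<open>W' \<le> - \<kappa> W\<close> and decays
  exponentially; with it \<open>e\<close>, \<open>z\<close> and \<open>v = z - P x\<close> vanish (\<open>observer_based_seeking_converges\<close>).

  Two facts tie this to the game. The derivative of \<open>P\<close> is the matrix \<open>H\<close>
  (\<open>pseudo_gradient_has_derivative\<close>): its \<open>(i, j)\<close> entry is \<open>\<partial>\<^sup>2f\<^sub>i / \<partial>x\<^sub>j \<partial>x\<^sub>i\<close>, while \<open>game_hessian\<close>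
  has \<open>\<partial>\<^sup>2f\<^sub>i / \<partial>x\<^sub>i \<partial>x\<^sub>j\<close>, and the two agree by symmetry of second derivatives. And
  the Nash equilibria are the zeros of \<open>P\<close>, because each cost is convex in the player's own action; a
  zero exists by Banach's fixed point theorem and is unique by strong monotonicity.
\<close>

section \<open>Symmetry of second derivatives\<close>

text \<open>The second-order difference over a parallelogram is symmetric in its two sides, but two
  applications of the mean value theorem, first along \<open>u\<close> and then along \<open>v\<close>, express it by the second
  derivative in one particular order.\<close>
lemma mixed_difference_mean_value:
  fixes f :: "'a::real_normed_vector \<Rightarrow> real"
  assumes f: "\<And>x. (f has_derivative blinfun_apply (g' x)) (at x)"
    and g: "\<And>x. (g' has_derivative blinfun_apply (g'' x)) (at x)"
    and "s > 0"
  obtains p where "dist p x \<le> s * (norm u + norm v)"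
    "f (x + s *\<^sub>R u + s *\<^sub>R v) - f (x + s *\<^sub>R u) - f (x + s *\<^sub>R v) + f x = s\<^sup>2 * g'' p v u"
proof -
  define \<phi> where "\<phi> \<tau> = f (x + \<tau> *\<^sub>R u + s *\<^sub>R v) - f (x + \<tau> *\<^sub>R u)" for \<tau>
  have f_line: "((\<lambda>\<tau>. f (w + \<tau> *\<^sub>R u)) has_real_derivative g' (w + \<tau> *\<^sub>R u) u) (at \<tau>)" for w \<tau>
    unfolding has_field_derivative_def
    by (rule has_derivative_eq_rhs,
        rule has_derivative_compose[of "\<lambda>\<tau>. w + \<tau> *\<^sub>R u", OF _ f])
       (auto intro!: derivative_eq_intros simp: blinfun.scaleR_right mult.commute)
  have g_line: "((\<lambda>\<sigma>. g' (w + \<sigma> *\<^sub>R v) u) has_real_derivative g'' (w + \<sigma> *\<^sub>R v) v u) (at \<sigma>)" for w \<sigma>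
  proof -
    have "((\<lambda>\<sigma>. g' (w + \<sigma> *\<^sub>R v)) has_derivative (\<lambda>h. g'' (w + \<sigma> *\<^sub>R v) (h *\<^sub>R v))) (at \<sigma>)"
      by (rule has_derivative_compose[of "\<lambda>\<sigma>. w + \<sigma> *\<^sub>R v", OF _ g])
         (auto intro!: derivative_eq_intros)
    then have "((\<lambda>\<sigma>. g' (w + \<sigma> *\<^sub>R v) u) has_derivative (\<lambda>h. g'' (w + \<sigma> *\<^sub>R v) (h *\<^sub>R v) u)) (at \<sigma>)"
      by (rule bounded_linear.has_derivative[OF blinfun.bounded_linear_left])
    then show ?thesis
      unfolding has_field_derivative_def
      by (rule has_derivative_eq_rhs) (auto simp: blinfun.scaleR_right blinfun.scaleR_left mult.commute)
  qed
  have "(\<phi> has_real_derivative g' (x + \<tau> *\<^sub>R u + s *\<^sub>R v) u - g' (x + \<tau> *\<^sub>R u) u) (at \<tau>)" for \<tau>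
    unfolding \<phi>_def
    using DERIV_diff[OF f_line[of "x + s *\<^sub>R v" \<tau>] f_line[of x \<tau>]] by (simp add: ac_simps)
  from MVT2[OF \<open>s > 0\<close> this] obtain \<tau> where \<tau>: "0 < \<tau>" "\<tau> < s"
    "\<phi> s - \<phi> 0 = s * (g' (x + \<tau> *\<^sub>R u + s *\<^sub>R v) u - g' (x + \<tau> *\<^sub>R u) u)"
    by auto
  from MVT2[OF \<open>s > 0\<close> g_line[of "x + \<tau> *\<^sub>R u"]] obtain \<sigma> where \<sigma>: "0 < \<sigma>" "\<sigma> < s"
    "g' (x + \<tau> *\<^sub>R u + s *\<^sub>R v) u - g' (x + \<tau> *\<^sub>R u) u = s * g'' (x + \<tau> *\<^sub>R u + \<sigma> *\<^sub>R v) v u"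
    by auto
  have "norm (\<tau> *\<^sub>R u + \<sigma> *\<^sub>R v) \<le> s * norm u + s * norm v"
    using \<tau>(1,2) \<sigma>(1,2) by (intro norm_triangle_le add_mono) (auto intro: mult_right_mono)
  then show thesis
    using \<tau> \<sigma>
    by (intro that[of "x + \<tau> *\<^sub>R u + \<sigma> *\<^sub>R v"])
       (simp_all add: \<phi>_def power2_eq_square dist_norm add.assoc distrib_left)
qed

text \<open>Applying the mean value expression to both orders of the sides gives two points, arbitrarily
  close to \<open>x\<close>, at which the two orders of differentiation agree; continuity carries this to \<open>x\<close>.\<close>
lemma second_derivative_symmetric:
  fixes f :: "'a::real_normed_vector \<Rightarrow> real"
  assumes f: "\<And>x. (f has_derivative blinfun_apply (g' x)) (at x)"
    and g: "\<And>x. (g' has_derivative blinfun_apply (g'' x)) (at x)"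
    and cont: "continuous_on UNIV g''"
  shows "g'' x u v = g'' x v u"
proof -
  define s where "s n = inverse (real (Suc n))" for n
  have s_pos: "s n > 0" for n by (simp add: s_def)
  have "s \<longlonglongrightarrow> 0" unfolding s_def by (rule LIMSEQ_inverse_real_of_nat)
  then have lim: "(\<lambda>n. s n * (norm u + norm v)) \<longlonglongrightarrow> 0" by (rule tendsto_mult_left_zero)
  have "\<exists>p q. dist p x \<le> s n * (norm u + norm v) \<and> dist q x \<le> s n * (norm u + norm v) \<and>
      g'' p v u = g'' q u v" for n
  proof -
    obtain p where p: "dist p x \<le> s n * (norm u + norm v)"
      "f (x + s n *\<^sub>R u + s n *\<^sub>R v) - f (x + s n *\<^sub>R u) - f (x + s n *\<^sub>R v) + f x
       = (s n)\<^sup>2 * g'' p v u"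
      by (rule mixed_difference_mean_value[OF f g s_pos])
    obtain q where q: "dist q x \<le> s n * (norm v + norm u)"
      "f (x + s n *\<^sub>R v + s n *\<^sub>R u) - f (x + s n *\<^sub>R v) - f (x + s n *\<^sub>R u) + f x
       = (s n)\<^sup>2 * g'' q u v"
      by (rule mixed_difference_mean_value[OF f g s_pos])
    have "x + s n *\<^sub>R v + s n *\<^sub>R u = x + s n *\<^sub>R u + s n *\<^sub>R v" by simp
    from p(2) q(2)[unfolded this] have "(s n)\<^sup>2 * g'' p v u = (s n)\<^sup>2 * g'' q u v"
      by linarith
    then have "g'' p v u = g'' q u v" using s_pos[of n] by simp
    with p(1) q(1) show ?thesis by (auto simp: add.commute)
  qed
  then obtain p q where near: "\<And>n. dist (p n) x \<le> s n * (norm u + norm v)"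
      "\<And>n. dist (q n) x \<le> s n * (norm u + norm v)"
    and eq: "\<And>n. g'' (p n) v u = g'' (q n) u v"
    by metis
  have second_lim: "(\<lambda>n. g'' (r n) a b) \<longlonglongrightarrow> g'' x a b"
    if "\<And>n. dist (r n) x \<le> s n * (norm u + norm v)" for r a b
  proof -
    have "r \<longlonglongrightarrow> x"
      by (rule metric_tendsto_imp_tendsto[OF lim, of _ _]) (use that in \<open>auto simp: dist_norm intro!: always_eventually order.trans[OF _ abs_ge_self]\<close>)
    then have "(\<lambda>n. g'' (r n)) \<longlonglongrightarrow> g'' x"
      using continuous_on_tendsto_compose[OF cont, of r x] by simp
    then show ?thesis by (intro blinfun.tendsto tendsto_const)
  qed
  show ?thesis
    using LIMSEQ_unique[OF second_lim[OF near(2)] second_lim[OF near(1), of v u, unfolded eq]] .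
qed

section \<open>The pseudo-gradient and Nash equilibria\<close>

lemma replace_entry_eq_add_axis: "replace_entry x i a = x + (a - x $ i) *\<^sub>R axis i 1"
  by (simp add: replace_entry_def vec_eq_iff axis_def)

lemma replace_entry_self [simp]: "replace_entry x i (x $ i) = x"
  by (simp add: replace_entry_eq_add_axis)

lemma has_real_derivative_replace_entry:
  fixes g :: "real ^ 'n::finite \<Rightarrow> real"
  assumes "(g has_derivative D) (at (replace_entry x i a))"
  shows "((\<lambda>b. g (replace_entry x i b)) has_real_derivative D (axis i 1)) (at a)"
proof -
  have "((\<lambda>b. replace_entry x i b) has_derivative (\<lambda>b. b *\<^sub>R axis i 1)) (at a)"
    unfolding replace_entry_eq_add_axis by (auto intro!: derivative_eq_intros)
  from has_derivative_compose[OF this assms] 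
  have "((\<lambda>b. g (replace_entry x i b)) has_derivative (\<lambda>b. D (b *\<^sub>R axis i 1))) (at a)" .
  then show ?thesis
    unfolding has_field_derivative_def
    by (rule has_derivative_eq_rhs)
       (simp add: linear.scaleR[OF has_derivative_linear[OF assms]] fun_eq_iff mult.commute)
qed

lemma partial_deriv_eq_axis:
  assumes "(g has_derivative D) (at x)"
  shows "partial_deriv i g x = D (axis i 1)"
  unfolding partial_deriv_def
  by (rule DERIV_imp_deriv, rule has_real_derivative_replace_entry) (use assms in simp)

text \<open>Differentiating \<open>\<partial>f\<^sub>i / \<partial>x\<^sub>i\<close> produces the mixed derivatives in the order opposite to
  \<open>game_hessian\<close>; symmetry of second derivatives closes the gap. This makes the hypothesis on the Hessian
  a bound on how fast the pseudo-gradient varies along a trajectory.\<close>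
lemma pseudo_gradient_has_derivative:
  fixes f :: "'n::finite \<Rightarrow> real ^ 'n \<Rightarrow> real"
  assumes "\<And>i. twice_continuously_differentiable (f i)"
  shows "(pseudo_gradient f has_derivative (\<lambda>w. game_hessian f x *v w)) (at x)"
proof -
  have "\<exists>g' g''. (\<forall>x. (f i has_derivative blinfun_apply (g' x)) (at x)) \<and>
        (\<forall>x. (g' has_derivative blinfun_apply (g'' x)) (at x)) \<and> continuous_on UNIV g''" for i
    using assms[of i] unfolding twice_continuously_differentiable_def .
  then obtain g' g'' where
    f: "\<And>i x. (f i has_derivative blinfun_apply (g' i x)) (at x)"
    and g: "\<And>i x. (g' i has_derivative blinfun_apply (g'' i x)) (at x)"
    and cont: "\<And>i. continuous_on UNIV (g'' i)"
    by metis
  have first: "partial_deriv j (f i) = (\<lambda>x. g' i x (axis j 1))" for i j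
    using partial_deriv_eq_axis[OF f] by blast
  have der: "((\<lambda>x. g' i x (axis j 1)) has_derivative (\<lambda>w. g'' i x w (axis j 1))) (at x)" for i j x
    by (rule bounded_linear.has_derivative[OF blinfun.bounded_linear_left g])
  have hess: "game_hessian f x $ i $ j = g'' i x (axis i 1) (axis j 1)" for i j x
    by (simp add: game_hessian_def first partial_deriv_eq_axis[OF der])
  have row: "(game_hessian f x *v w) $ i = g'' i x w (axis i 1)" for i w x
  proof -
    have "(game_hessian f x *v w) $ i = (\<Sum>j\<in>UNIV. g'' i x (axis i 1) (w $ j *\<^sub>R axis j 1))"
      by (simp add: matrix_vector_mult_def hess blinfun.scaleR_right mult.commute)
    also have "\<dots> = g'' i x (axis i 1) (\<Sum>j\<in>UNIV. w $ j *\<^sub>R axis j 1)"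
      by (simp add: blinfun.sum_right)
    also have "(\<Sum>j\<in>UNIV. w $ j *\<^sub>R axis j 1) = w"
      by (simp add: basis_expansion flip: scalar_mult_eq_scaleR)
    also have "g'' i x (axis i 1) w = g'' i x w (axis i 1)"
      by (rule second_derivative_symmetric[OF f g cont])
    finally show ?thesis .
  qed
  show ?thesis
    unfolding has_derivative_componentwise_within[of "pseudo_gradient f"]
    by (auto simp: Basis_vec_def inner_axis row pseudo_gradient_def first der)
qed

text \<open>A small step \<open>x - \<tau> P x\<close> of gradient play is a contraction: the monotone part shrinks squared
  distances to first order in \<open>\<tau>\<close>, whereas the Lipschitz part enlarges them only to second order. Its fixed
  point is a zero of \<open>P\<close>.\<close>
lemma strongly_monotone_lipschitz_has_zero:
  fixes P :: "'a::{real_inner, complete_space} \<Rightarrow> 'a"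
  assumes mono: "\<And>x y. (x - y) \<bullet> (P x - P y) \<ge> m * (norm (x - y))\<^sup>2" and "m > 0"
    and lip: "\<And>x y. norm (P x - P y) \<le> K * norm (x - y)" and "K \<ge> 0"
  shows "\<exists>x. P x = 0"
proof -
  \<comment> \<open>Any \<open>L \<ge> K\<close> is a Lipschitz constant, and \<open>L \<ge> m\<close> keeps the squared contraction factor \<open>q\<close>
    nonnegative; the step \<open>m / L\<^sup>2\<close> minimises \<open>1 - 2 \<tau> m + \<tau>\<^sup>2 L\<^sup>2\<close>.\<close>
  define L where "L = K + m"
  have L: "L > 0" "K \<le> L" "m \<le> L" using \<open>m > 0\<close> \<open>K \<ge> 0\<close> by (auto simp: L_def)
  define \<tau> where "\<tau> = m / L\<^sup>2"
  define q where "q = 1 - m\<^sup>2 / L\<^sup>2"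
  have "\<tau> > 0" using L \<open>m > 0\<close> by (simp add: \<tau>_def)
  have "m\<^sup>2 \<le> L\<^sup>2" using L \<open>m > 0\<close> by (intro power_mono) auto
  then have q: "0 \<le> q" "q < 1" using L \<open>m > 0\<close> by (simp_all add: q_def)
  have step: "dist (x - \<tau> *\<^sub>R P x) (y - \<tau> *\<^sub>R P y) \<le> sqrt q * dist x y" for x y
  proof -
    let ?d = "x - y" and ?p = "P x - P y"
    have "norm ?p \<le> L * norm ?d"
      using lip[of x y] mult_right_mono[OF L(2) norm_ge_zero[of ?d]] by linarith
    then have "(norm ?p)\<^sup>2 \<le> L\<^sup>2 * (norm ?d)\<^sup>2"
      using power_mono[of "norm ?p" "L * norm ?d" 2] by (simp add: power_mult_distrib)
    then have p2: "\<tau>\<^sup>2 * (norm ?p)\<^sup>2 \<le> \<tau>\<^sup>2 * (L\<^sup>2 * (norm ?d)\<^sup>2)" by (simp add: mult_left_mono)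
    have p1: "2 * \<tau> * (m * (norm ?d)\<^sup>2) \<le> 2 * \<tau> * (?d \<bullet> ?p)"
      using mono[of x y] \<open>\<tau> > 0\<close> by simp
    have expand: "(norm (d - \<tau> *\<^sub>R p))\<^sup>2 = (norm d)\<^sup>2 - 2 * \<tau> * (d \<bullet> p) + \<tau>\<^sup>2 * (norm p)\<^sup>2" for d p :: 'a
      unfolding power2_norm_eq_inner power2_eq_square[of \<tau>]
      by (simp add: inner_diff_left inner_diff_right inner_commute algebra_simps del: dot_square_norm)
    have "(norm (?d - \<tau> *\<^sub>R ?p))\<^sup>2 \<le> (norm ?d)\<^sup>2 - 2 * \<tau> * (m * (norm ?d)\<^sup>2) + \<tau>\<^sup>2 * (L\<^sup>2 * (norm ?d)\<^sup>2)"
      unfolding expand using p1 p2 by linarith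
    also have "\<dots> = q * (norm ?d)\<^sup>2"
      using L by (simp add: \<tau>_def q_def field_simps power2_eq_square)
    finally have "norm (?d - \<tau> *\<^sub>R ?p) \<le> sqrt (q * (norm ?d)\<^sup>2)" by (rule real_le_rsqrt)
    moreover have "x - \<tau> *\<^sub>R P x - (y - \<tau> *\<^sub>R P y) = ?d - \<tau> *\<^sub>R ?p"
      by (simp add: scaleR_diff_right)
    ultimately show ?thesis unfolding dist_norm by (simp only: real_sqrt_mult) simp
  qed
  have "\<exists>!x\<in>UNIV. x - \<tau> *\<^sub>R P x = x"
    by (rule Banach_fix[where c = "sqrt q"]) (use q step in \<open>auto simp: complete_UNIV\<close>)
  then obtain x where "x - \<tau> *\<^sub>R P x = x" by blast
  then have "\<tau> *\<^sub>R P x = 0" by (simp add: diff_eq_eq)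
  then show ?thesis using \<open>\<tau> > 0\<close> by auto
qed

lemma monotone_derivative_zero_imp_minimum:
  fixes \<phi> :: "real \<Rightarrow> real"
  assumes der: "\<And>a. (\<phi> has_real_derivative \<psi> a) (at a)"
    and mono: "\<And>a b. (a - b) * (\<psi> a - \<psi> b) \<ge> 0" and "\<psi> c = 0"
  shows "\<phi> c \<le> \<phi> a"
proof (cases c a rule: linorder_cases)
  case less
  from MVT2[OF less der] obtain z where "c < z" "\<phi> a - \<phi> c = (a - c) * \<psi> z" by auto
  moreover have "\<psi> z \<ge> 0" 
    using mono[of z c] \<open>c < z\<close> \<open>\<psi> c = 0\<close> by (simp add: zero_le_mult_iff)
  ultimately show ?thesis using less by (smt (verit) mult_nonneg_nonneg)
next
  case greater
  from MVT2[OF greater der] obtain z where "z < c" "\<phi> c - \<phi> a = (c - a) * \<psi> z" by auto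
  moreover have "\<psi> z \<le> 0" 
    using mono[of z c] \<open>z < c\<close> \<open>\<psi> c = 0\<close> by (simp add: zero_le_mult_iff)
  ultimately show ?thesis using greater by (smt (verit) mult_nonneg_nonpos)
qed simp

text \<open>Monotonicity of the pseudo-gradient, tested on two profiles that differ only in the action of
  player \<open>i\<close>, says that \<open>\<partial>f\<^sub>i / \<partial>x\<^sub>i\<close> is nondecreasing in that action. So the first-order
  condition is sufficient for a global best response as well as necessary.\<close>
lemma nash_equilibrium_iff_pseudo_gradient_zero:
  fixes f :: "'n::finite \<Rightarrow> real ^ 'n \<Rightarrow> real"
  assumes diff: "\<And>i x. f i differentiable at x"
    and mono: "\<And>x y. (x - y) \<bullet> (pseudo_gradient f x - pseudo_gradient f y) \<ge> 0"
  shows "nash_equilibrium f x \<longleftrightarrow> pseudo_gradient f x = 0"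
proof -
  have der: "((\<lambda>b. f i (replace_entry x i b)) has_real_derivative
      partial_deriv i (f i) (replace_entry x i a)) (at a)" for i a
  proof -
    obtain D where D: "(f i has_derivative D) (at (replace_entry x i a))"
      using diff[of i] by (auto simp: differentiable_def)
    from has_real_derivative_replace_entry[OF D] show ?thesis
      by (simp add: partial_deriv_eq_axis[OF D])
  qed
  show ?thesis
  proof
    assume nash: "nash_equilibrium f x"
    have "partial_deriv i (f i) x = 0" for i
      using DERIV_local_min[OF der[of i "x $ i"], of 1] nash by (simp add: nash_equilibrium_def)
    then show "pseudo_gradient f x = 0" by (simp add: pseudo_gradient_def vec_eq_iff)
  next
    assume zero: "pseudo_gradient f x = 0"
    have "f i x \<le> f i (replace_entry x i a)" for i a
    proof -
      let ?\<psi> = "\<lambda>a. partial_deriv i (f i) (replace_entry x i a)"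
      have "(a - b) * (?\<psi> a - ?\<psi> b) \<ge> 0" for a b
        using mono[of "replace_entry x i a" "replace_entry x i b"]
        by (simp add: replace_entry_eq_add_axis pseudo_gradient_def inner_axis' flip: scaleR_diff_left)
      moreover have "?\<psi> (x $ i) = 0"
        using zero by (simp add: pseudo_gradient_def vec_eq_iff)
      ultimately have "f i (replace_entry x i (x $ i)) \<le> f i (replace_entry x i a)"
        by (rule monotone_derivative_zero_imp_minimum[OF der])
      then show ?thesis by simp
    qed
    then show "nash_equilibrium f x" by (simp add: nash_equilibrium_def)
  qed
qed

text \<open>This is the source of the factor \<open>sqrt N\<close> in the gain conditions: it passes from the Lipschitz
  constants of the entries of the pseudo-gradient to one for the whole vector.\<close>
lemma norm_le_sqrt_card_mult:
  fixes z :: "real ^ 'n::finite"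
  assumes "\<And>i. \<bar>z $ i\<bar> \<le> B"
  shows "norm z \<le> sqrt (real CARD('n)) * B"
proof -
  have "B \<ge> 0" using assms[of undefined] by linarith
  have "(norm z)\<^sup>2 = (\<Sum>i\<in>UNIV. (z $ i)\<^sup>2)"
    by (simp add: norm_vec_def L2_set_def sum_nonneg)
  also have "\<dots> \<le> (\<Sum>i\<in>(UNIV::'n set). B\<^sup>2)"
    using assms by (intro sum_mono abs_le_square_iff[THEN iffD1]) (smt (verit))
  finally have "norm z \<le> sqrt (real CARD('n) * B\<^sup>2)" by (intro real_le_rsqrt) simp
  then show ?thesis using \<open>B \<ge> 0\<close> by (simp add: real_sqrt_mult)
qed

section \<open>Differential inequalities and vector calculus\<close>

text \<open>A Gronwall argument: \<open>W t * exp (\<kappa> * t)\<close> has nonpositive derivative. The derivative is one-sided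
  at \<open>0\<close>, matching the time domain of the closed loop.\<close>

lemma exponential_decay:
  fixes W :: "real \<Rightarrow> real"
  assumes der: "\<And>t. t \<ge> 0 \<Longrightarrow> (W has_real_derivative W' t) (at t within {0..})"
    and dec: "\<And>t. t \<ge> 0 \<Longrightarrow> W' t \<le> - \<kappa> * W t" and "t \<ge> 0"
  shows "W t \<le> W 0 * exp (- \<kappa> * t)"
proof -
  define U where "U t = W t * exp (\<kappa> * t)" for t
  have U: "(U has_real_derivative (W' t + \<kappa> * W t) * exp (\<kappa> * t)) (at t within {0..})" if "t \<ge> 0" for t
    unfolding U_def by (auto intro!: derivative_eq_intros der that simp: algebra_simps)
  have "U t \<le> U 0"
  proof (rule DERIV_nonpos_imp_decreasing_open[OF \<open>t \<ge> 0\<close>])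
    fix s :: real assume s: "0 < s" "s < t"
    have "at s within {0..} = at s" by (rule at_within_interior) (use s in simp)
    with U[of s] s have "(U has_real_derivative (W' s + \<kappa> * W s) * exp (\<kappa> * s)) (at s)" by simp
    moreover have "(W' s + \<kappa> * W s) * exp (\<kappa> * s) \<le> 0"
      using dec[of s] s by (intro mult_nonpos_nonneg) auto
    ultimately show "\<exists>y. DERIV U s :> y \<and> y \<le> 0" by blast
  next
    have "continuous_on {0..} U"
      unfolding continuous_on_eq_continuous_within by (auto intro: DERIV_continuous U)
    then show "continuous_on {0..t} U" by (rule continuous_on_subset) auto
  qed
  then have "W t * exp (\<kappa> * t) * exp (- \<kappa> * t) \<le> W 0 * exp (- \<kappa> * t)"
    by (intro mult_right_mono) (simp_all add: U_def)
  then show ?thesis by (simp add: mult.assoc flip: exp_add)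
qed

lemma has_vector_derivative_componentwise:
  fixes g :: "real \<Rightarrow> real ^ 'n::finite"
  assumes "\<And>i. ((\<lambda>s. g s $ i) has_real_derivative g' $ i) (at t within S)"
  shows "(g has_vector_derivative g') (at t within S)"
  unfolding has_vector_derivative_def has_derivative_componentwise_within[of g]
  using assms
  by (auto simp: Basis_vec_def inner_axis has_field_derivative_def mult_commute_abs)

lemma has_real_derivative_inner:
  assumes "(p has_vector_derivative p') (at t within S)" "(q has_vector_derivative q') (at t within S)"
  shows "((\<lambda>s. p s \<bullet> q s) has_real_derivative p t \<bullet> q' + p' \<bullet> q t) (at t within S)"
  using bounded_bilinear.has_vector_derivative[OF bounded_bilinear_inner assms]
  by (simp add: has_real_derivative_iff_has_vector_derivative)

lemma weighted_young:
  fixes a b c :: real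
  assumes "c > 0"
  shows "a * b \<le> c / 2 * a\<^sup>2 + b\<^sup>2 / (2 * c)"
proof -
  have "0 \<le> (c * a - b)\<^sup>2 / (2 * c)" using assms by simp
  also have "\<dots> = c / 2 * a\<^sup>2 + b\<^sup>2 / (2 * c) - a * b"
    using assms by (simp add: power2_eq_square field_simps)
  finally show ?thesis by simp
qed

section \<open>A Lyapunov function for the observer error\<close>

text \<open>The errors obey \<open>a' = b - k2 a\<close>, \<open>b' = - k3 a\<close>. Along them \<open>k3 |a|\<^sup>2 + |b|\<^sup>2\<close> has derivative
  \<open>- 2 k2 k3 |a|\<^sup>2\<close>, which does not control \<open>b\<close>. A small cross term \<open>- 2 \<delta> (a \<bullet> b)\<close> adds
  \<open>- 2 \<delta> |b|\<^sup>2\<close> at the expense of terms that spend part of the decay in \<open>a\<close>; this \<open>\<delta>\<close> spends exactly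
  half of it.\<close>

definition observer_cross_weight :: "real \<Rightarrow> real \<Rightarrow> real" where
  "observer_cross_weight k2 k3 = k2 * k3 / (2 * k3 + k2\<^sup>2)"

definition observer_energy :: "real \<Rightarrow> real \<Rightarrow> 'a::real_inner \<Rightarrow> 'a \<Rightarrow> real" where
  "observer_energy k2 k3 a b = k3 * (a \<bullet> a) + b \<bullet> b - 2 * observer_cross_weight k2 k3 * (a \<bullet> b)"

text \<open>The second bound keeps the energy positive despite its cross term. The third is the balance
  by which half of the decay in \<open>a\<close> survives.\<close>
lemma observer_cross_weight_bounds:
  assumes "k2 > 0" "k3 > 0"
  shows "observer_cross_weight k2 k3 > 0"
    and "(observer_cross_weight k2 k3)\<^sup>2 \<le> k3 / 8"
    and "observer_cross_weight k2 k3 * (2 * k3 + k2\<^sup>2) = k2 * k3"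
proof -
  have pos: "2 * k3 + k2\<^sup>2 > 0" using assms by (simp add: add_pos_pos)
  show "observer_cross_weight k2 k3 > 0"
    using assms pos by (simp add: observer_cross_weight_def)
  show eq: "observer_cross_weight k2 k3 * (2 * k3 + k2\<^sup>2) = k2 * k3"
    using pos by (simp add: observer_cross_weight_def)
  have "0 \<le> (2 * k3 - k2\<^sup>2)\<^sup>2" by simp
  then have "8 * k3 * k2\<^sup>2 \<le> (2 * k3 + k2\<^sup>2)\<^sup>2" by (simp add: power2_eq_square algebra_simps)
  then have "8 * k3 * k2\<^sup>2 * (k3 / 8) \<le> (2 * k3 + k2\<^sup>2)\<^sup>2 * (k3 / 8)"
    using assms by (intro mult_right_mono) auto
  then have "(k2 * k3)\<^sup>2 \<le> (2 * k3 + k2\<^sup>2)\<^sup>2 * (k3 / 8)" by (simp add: power2_eq_square mult_ac)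
  then show "(observer_cross_weight k2 k3)\<^sup>2 \<le> k3 / 8"
    using pos by (simp add: observer_cross_weight_def power_divide divide_le_eq mult.commute)
qed

lemma observer_energy_bounds:
  assumes "k2 > 0" "k3 > 0"
  shows "0 \<le> observer_energy k2 k3 a b"
    and "observer_energy k2 k3 a b \<le> 5 / 4 * k3 * (norm a)\<^sup>2 + 3 / 2 * (norm b)\<^sup>2"
proof -
  let ?\<delta> = "observer_cross_weight k2 k3"
  have "2 * \<bar>?\<delta> * (a \<bullet> b)\<bar> \<le> 2 * ((?\<delta> * norm a) * norm b)"
    using Cauchy_Schwarz_ineq2[of a b] observer_cross_weight_bounds(1)[OF assms]
    by (simp add: abs_mult mult.assoc mult_left_mono)
  also have "\<dots> \<le> 2 * (?\<delta>\<^sup>2 * (norm a)\<^sup>2 + (norm b)\<^sup>2 / 4)"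
    using weighted_young[of 2 "?\<delta> * norm a" "norm b"] by (simp add: power_mult_distrib)
  also have "\<dots> \<le> 2 * (k3 / 8 * (norm a)\<^sup>2 + (norm b)\<^sup>2 / 4)"
    using observer_cross_weight_bounds(2)[OF assms] by (intro mult_left_mono add_right_mono mult_right_mono) auto
  finally have cross: "\<bar>2 * ?\<delta> * (a \<bullet> b)\<bar> \<le> k3 / 4 * (norm a)\<^sup>2 + (norm b)\<^sup>2 / 2"
    by (simp add: abs_mult)
  have "0 \<le> k3 * (norm a)\<^sup>2" using assms by simp
  with cross show "0 \<le> observer_energy k2 k3 a b"
    and "observer_energy k2 k3 a b \<le> 5 / 4 * k3 * (norm a)\<^sup>2 + 3 / 2 * (norm b)\<^sup>2"
    unfolding observer_energy_def power2_norm_eq_inner[symmetric]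
    by (auto simp: abs_le_iff algebra_simps)
qed

text \<open>The dissipation \<open>k2 k3 |a|\<^sup>2 + \<delta> |b|\<^sup>2\<close> is split: half of its \<open>b\<close> part is set aside to absorb
  the disturbance that the velocity estimate causes in the players' dynamics, and the rest dominates a
  multiple of the energy, the rate \<open>\<mu>\<close> being read off from the upper bound of \<open>observer_energy_bounds\<close>.\<close>
lemma observer_energy_dissipation:
  assumes "k2 > 0" "k3 > 0" and a': "a' = b - k2 *\<^sub>R a" and b': "b' = - k3 *\<^sub>R a"
  shows "2 * k3 * (a \<bullet> a') + 2 * (b \<bullet> b') - 2 * observer_cross_weight k2 k3 * (a \<bullet> b' + a' \<bullet> b)
     \<le> - min (4 * k2 / 5) (observer_cross_weight k2 k3 / 3) * observer_energy k2 k3 a b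
        - observer_cross_weight k2 k3 / 2 * (norm b)\<^sup>2"
proof -
  define \<delta> where "\<delta> = observer_cross_weight k2 k3"
  define \<mu> where "\<mu> = min (4 * k2 / 5) (\<delta> / 3)"
  note \<delta> = observer_cross_weight_bounds[OF assms(1,2), folded \<delta>_def]
  have cross: "k2 * (a \<bullet> b) \<le> k2\<^sup>2 / 2 * (norm a)\<^sup>2 + (norm b)\<^sup>2 / 2"
  proof -
    have "k2 * (a \<bullet> b) \<le> k2 * norm a * norm b"
      using assms(1) norm_cauchy_schwarz[of a b] by (simp add: mult.assoc)
    also have "\<dots> \<le> k2\<^sup>2 / 2 * (norm a)\<^sup>2 + (norm b)\<^sup>2 / 2"
      using weighted_young[of 1 "k2 * norm a" "norm b"] by (simp add: power_mult_distrib)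
    finally show ?thesis .
  qed
  have "2 * k3 * (a \<bullet> a') + 2 * (b \<bullet> b') - 2 * \<delta> * (a \<bullet> b' + a' \<bullet> b)
      = (2 * \<delta> * k3 - 2 * k2 * k3) * (norm a)\<^sup>2 - 2 * \<delta> * (norm b)\<^sup>2 + 2 * \<delta> * (k2 * (a \<bullet> b))"
    unfolding a' b' power2_norm_eq_inner
    by (simp add: inner_diff_left inner_diff_right inner_commute algebra_simps)
  also have "\<dots> \<le> (2 * \<delta> * k3 - 2 * k2 * k3) * (norm a)\<^sup>2 - 2 * \<delta> * (norm b)\<^sup>2
      + 2 * \<delta> * (k2\<^sup>2 / 2 * (norm a)\<^sup>2 + (norm b)\<^sup>2 / 2)"
    using cross \<delta>(1) by (intro add_left_mono mult_left_mono) auto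
  also have "\<dots> = (\<delta> * (2 * k3 + k2\<^sup>2) - 2 * (k2 * k3)) * (norm a)\<^sup>2 - \<delta> * (norm b)\<^sup>2"
    by (simp add: algebra_simps)
  also have "\<dots> = - (k2 * k3 * (norm a)\<^sup>2 + \<delta> * (norm b)\<^sup>2)"
    unfolding \<delta>(3) by (simp add: algebra_simps)
  finally have dissipation: "2 * k3 * (a \<bullet> a') + 2 * (b \<bullet> b') - 2 * \<delta> * (a \<bullet> b' + a' \<bullet> b)
      \<le> - (k2 * k3 * (norm a)\<^sup>2 + \<delta> * (norm b)\<^sup>2)" .
  have \<mu>: "0 \<le> \<mu>" "\<mu> \<le> 4 * k2 / 5" "\<mu> \<le> \<delta> / 3" using assms \<delta>(1) by (auto simp: \<mu>_def)
  have "\<mu> * observer_energy k2 k3 a b \<le> \<mu> * (5 / 4 * k3 * (norm a)\<^sup>2) + \<mu> * (3 / 2 * (norm b)\<^sup>2)"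
    using mult_left_mono[OF observer_energy_bounds(2)[OF assms(1,2), of a b] \<mu>(1)]
    by (simp only: distrib_left)
  also have "\<dots> \<le> 4 * k2 / 5 * (5 / 4 * k3 * (norm a)\<^sup>2) + \<delta> / 3 * (3 / 2 * (norm b)\<^sup>2)"
    using \<mu> assms(2) by (intro add_mono mult_right_mono) auto
  also have "\<dots> = k2 * k3 * (norm a)\<^sup>2 + \<delta> / 2 * (norm b)\<^sup>2" by simp
  finally show ?thesis using dissipation unfolding \<delta>_def \<mu>_def by linarith
qed

section \<open>Convergence of the closed loop\<close>

text \<open>The derivative of \<open>(|e|\<^sup>2 + |z|\<^sup>2) / 2\<close> along the closed loop, with \<open>p\<close> standing for \<open>P x\<close> and
  \<open>q\<close> for the derivative of \<open>P\<close> in the direction \<open>v = z - p\<close>. The products \<open>|e| |z|\<close> and \<open>|z| |b|\<close> are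
  split by Young's inequality with the weights \<open>\<epsilon>1\<close> and \<open>\<epsilon>2\<close>.\<close>

lemma seeking_energy_dissipation:
  fixes e z p b q :: "'a::real_inner"
  assumes mono: "e \<bullet> p \<ge> m * (norm e)\<^sup>2" and p: "norm p \<le> K * norm e"
    and q: "norm q \<le> h * norm (z - p)" and "h > 0" "k1 > 0" "\<epsilon>1 > 0" "\<epsilon>2 > 0"
    and "K \<ge> 0"
  shows "e \<bullet> (z - p) + z \<bullet> (q - k1 *\<^sub>R z - k1 *\<^sub>R b)
     \<le> - (m - \<epsilon>1 * (h * K + 1) / 2) * (norm e)\<^sup>2
        - (k1 - h - (h * K + 1) / (2 * \<epsilon>1) - k1 / (2 * \<epsilon>2)) * (norm z)\<^sup>2
        + \<epsilon>2 * k1 / 2 * (norm b)\<^sup>2"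
proof -
  have ez: "e \<bullet> z \<le> norm e * norm z" by (rule norm_cauchy_schwarz)
  have "norm (z - p) \<le> norm z + K * norm e" using norm_triangle_ineq4[of z p] p by linarith
  then have "norm q \<le> h * (norm z + K * norm e)"
    using \<open>h > 0\<close> by (intro order_trans[OF q] mult_left_mono) auto
  then have "norm z * norm q \<le> norm z * (h * (norm z + K * norm e))"
    by (rule mult_left_mono) simp
  then have zq: "z \<bullet> q \<le> h * (norm z)\<^sup>2 + h * K * (norm e * norm z)"
    using norm_cauchy_schwarz[of z q] by (simp add: power2_eq_square algebra_simps)
  have "- (z \<bullet> b) \<le> norm b * norm z" using norm_cauchy_schwarz[of z "- b"] by (simp add: mult.commute)
  also have "\<dots> \<le> \<epsilon>2 / 2 * (norm b)\<^sup>2 + (norm z)\<^sup>2 / (2 * \<epsilon>2)"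
    by (rule weighted_young) fact
  finally have "k1 * (- (z \<bullet> b)) \<le> k1 * (\<epsilon>2 / 2 * (norm b)\<^sup>2 + (norm z)\<^sup>2 / (2 * \<epsilon>2))"
    using \<open>k1 > 0\<close> by (intro mult_left_mono) auto
  then have zb: "- (k1 * (z \<bullet> b)) \<le> \<epsilon>2 * k1 / 2 * (norm b)\<^sup>2 + k1 / (2 * \<epsilon>2) * (norm z)\<^sup>2"
    by (simp add: algebra_simps)
  have "(h * K + 1) * (norm e * norm z)
      \<le> (h * K + 1) * (\<epsilon>1 / 2 * (norm e)\<^sup>2 + (norm z)\<^sup>2 / (2 * \<epsilon>1))"
    using weighted_young[OF \<open>\<epsilon>1 > 0\<close>] \<open>h > 0\<close> \<open>K \<ge> 0\<close> by (intro mult_left_mono) auto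
  then have coupling: "(h * K + 1) * (norm e * norm z)
      \<le> \<epsilon>1 * (h * K + 1) / 2 * (norm e)\<^sup>2 + (h * K + 1) / (2 * \<epsilon>1) * (norm z)\<^sup>2"
    by (simp add: algebra_simps add_divide_distrib)
  have "e \<bullet> (z - p) + z \<bullet> (q - k1 *\<^sub>R z - k1 *\<^sub>R b)
      = e \<bullet> z - e \<bullet> p + z \<bullet> q - k1 * (norm z)\<^sup>2 - k1 * (z \<bullet> b)"
    unfolding power2_norm_eq_inner by (simp add: inner_diff_right)
  also have "\<dots> \<le> (h * K + 1) * (norm e * norm z) - m * (norm e)\<^sup>2 + h * (norm z)\<^sup>2
      - k1 * (norm z)\<^sup>2 - k1 * (z \<bullet> b)"
    using ez mono zq by (simp add: algebra_simps)
  finally show ?thesis using coupling zb by (simp add: algebra_simps)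
qed

text \<open>The bounds on \<open>\<epsilon>1\<close> and \<open>k1\<close> are the positivity of the two decay rates in
  \<open>seeking_energy_dissipation\<close>, solved for these parameters; \<open>\<epsilon>2 > 1 / 2\<close> leaves a positive
  fraction \<open>1 - 1 / (2 \<epsilon>2)\<close> of the gain \<open>k1\<close>.\<close>
lemma gain_conditions_imp_positive_rates:
  fixes m h K k1 \<epsilon>1 \<epsilon>2 :: real
  assumes "h > 0" "K \<ge> 0" "\<epsilon>1 > 0" "\<epsilon>2 > 1 / 2"
    and \<epsilon>1: "\<epsilon>1 < 2 * m / (h * K + 1)"
    and k1: "k1 > \<epsilon>2 * (2 * \<epsilon>1 * h + h * K + 1) / (\<epsilon>1 * (2 * \<epsilon>2 - 1))"
  shows "m - \<epsilon>1 * (h * K + 1) / 2 > 0"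
    and "k1 - h - (h * K + 1) / (2 * \<epsilon>1) - k1 / (2 * \<epsilon>2) > 0"
proof -
  have "h * K + 1 > 0" using assms(1,2) by (simp add: add_nonneg_pos)
  with \<epsilon>1 show "m - \<epsilon>1 * (h * K + 1) / 2 > 0" by (simp add: less_divide_eq)
  have pos: "\<epsilon>1 * (2 * \<epsilon>2 - 1) > 0" using assms(3,4) by simp
  with k1 have "\<epsilon>2 * (2 * \<epsilon>1 * h + h * K + 1) < k1 * (\<epsilon>1 * (2 * \<epsilon>2 - 1))"
    by (simp only: divide_less_eq if_True)
  then have "0 < (k1 * (\<epsilon>1 * (2 * \<epsilon>2 - 1)) - \<epsilon>2 * (2 * \<epsilon>1 * h + h * K + 1)) / (2 * \<epsilon>1 * \<epsilon>2)"
    using assms(3,4) by simp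
  also have "\<dots> = k1 - h - (h * K + 1) / (2 * \<epsilon>1) - k1 / (2 * \<epsilon>2)"
    using assms(3,4) by (simp add: field_simps)
  finally show "k1 - h - (h * K + 1) / (2 * \<epsilon>1) - k1 / (2 * \<epsilon>2) > 0" .
qed

text \<open>The game enters only through a strongly monotone Lipschitz map \<open>P\<close> with a bounded derivative, so the
  result holds in any real inner product space.\<close>
lemma observer_based_seeking_converges:
  fixes P :: "'a::real_inner \<Rightarrow> 'a" and J :: "'a \<Rightarrow> 'a \<Rightarrow> 'a"
    and x v xb vb :: "real \<Rightarrow> 'a"
  assumes P_der: "\<And>y. (P has_derivative J y) (at y)"
    and J_bound: "\<And>y w. norm (J y w) \<le> h * norm w" and "h > 0"
    and mono: "\<And>y y'. (y - y') \<bullet> (P y - P y') \<ge> m * (norm (y - y'))\<^sup>2"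
    and lip: "\<And>y y'. norm (P y - P y') \<le> K * norm (y - y')" and "K \<ge> 0"
    and zero: "P xs = 0"
    and gains: "k1 > 0" "k2 > 0" "k3 > 0" "\<epsilon>1 > 0" "\<epsilon>2 > 1 / 2"
      "\<epsilon>1 < 2 * m / (h * K + 1)"
      "k1 > \<epsilon>2 * (2 * \<epsilon>1 * h + h * K + 1) / (\<epsilon>1 * (2 * \<epsilon>2 - 1))"
    and x: "\<And>t. t \<ge> 0 \<Longrightarrow> (x has_vector_derivative v t) (at t within {0..})"
    and v: "\<And>t. t \<ge> 0 \<Longrightarrow>
      (v has_vector_derivative - k1 *\<^sub>R P (x t) - k1 *\<^sub>R vb t) (at t within {0..})"
    and xb: "\<And>t. t \<ge> 0 \<Longrightarrow>
      (xb has_vector_derivative - k2 *\<^sub>R (xb t - x t) + vb t) (at t within {0..})"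
    and vb: "\<And>t. t \<ge> 0 \<Longrightarrow>
      (vb has_vector_derivative - k3 *\<^sub>R (xb t - x t) + (- k1 *\<^sub>R P (x t) - k1 *\<^sub>R vb t)) (at t within {0..})"
  shows "((\<lambda>t. norm (x t - xs)) \<longlongrightarrow> 0) at_top" and "((\<lambda>t. norm (v t)) \<longlongrightarrow> 0) at_top"
proof -
  define e where "e t = x t - xs" for t
  define z where "z t = v t + P (x t)" for t
  define a where "a t = xb t - x t" for t
  define b where "b t = vb t - v t" for t
  define z' where "z' t = J (x t) (v t) - k1 *\<^sub>R z t - k1 *\<^sub>R b t" for t
  have e_der: "(e has_vector_derivative v t) (at t within {0..})" if "t \<ge> 0" for t
    unfolding e_def using x[OF that] by (auto intro!: derivative_eq_intros)
  have z_der: "(z has_vector_derivative z' t) (at t within {0..})" if "t \<ge> 0" for t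
  proof -
    have "((P \<circ> x) has_vector_derivative J (x t) (v t)) (at t within {0..})"
      by (rule vector_derivative_diff_chain_within[OF x[OF that] has_derivative_at_withinI[OF P_der]])
    from has_vector_derivative_add[OF v[OF that] this] show ?thesis
      unfolding z_def o_def by (rule has_vector_derivative_eq_rhs) (simp add: z'_def z_def b_def algebra_simps)
  qed
  have a_der: "(a has_vector_derivative b t - k2 *\<^sub>R a t) (at t within {0..})" if "t \<ge> 0" for t
    using has_vector_derivative_diff[OF xb[OF that] x[OF that]]
    unfolding a_def by (rule has_vector_derivative_eq_rhs) (simp add: b_def algebra_simps)
  have b_der: "(b has_vector_derivative - k3 *\<^sub>R a t) (at t within {0..})" if "t \<ge> 0" for t
    using has_vector_derivative_diff[OF vb[OF that] v[OF that]]
    unfolding b_def by (rule has_vector_derivative_eq_rhs) (simp add: a_def algebra_simps)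

  define \<delta> where "\<delta> = observer_cross_weight k2 k3"
  have "\<delta> > 0" unfolding \<delta>_def using observer_cross_weight_bounds(1) gains by simp
  \<comment> \<open>With this weight the part \<open>\<gamma> \<delta> / 2\<close> of the observer dissipation exactly cancels the disturbance
    \<open>\<epsilon>2 k1 / 2 |b|\<^sup>2\<close>.\<close>
  define \<gamma> where "\<gamma> = \<epsilon>2 * k1 / \<delta>"
  have "\<gamma> > 0" using gains \<open>\<delta> > 0\<close> by (simp add: \<gamma>_def)
  define Q where "Q t = observer_energy k2 k3 (a t) (b t)" for t
  define Q' where "Q' t = 2 * k3 * (a t \<bullet> (b t - k2 *\<^sub>R a t)) + 2 * (b t \<bullet> (- k3 *\<^sub>R a t))
     - 2 * \<delta> * (a t \<bullet> (- k3 *\<^sub>R a t) + (b t - k2 *\<^sub>R a t) \<bullet> b t)" for t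
  define W where "W t = (e t \<bullet> e t) / 2 + (z t \<bullet> z t) / 2 + \<gamma> * Q t" for t
  define W' where "W' t = e t \<bullet> v t + z t \<bullet> z' t + \<gamma> * Q' t" for t
  have Q_der: "(Q has_real_derivative Q' t) (at t within {0..})" if "t \<ge> 0" for t
    unfolding Q_def observer_energy_def \<delta>_def[symmetric] Q'_def
    by (rule derivative_eq_intros has_real_derivative_inner a_der b_der that refl)+
       (simp add: inner_commute algebra_simps)
  have W_der: "(W has_real_derivative W' t) (at t within {0..})" if "t \<ge> 0" for t
  proof -
    have "((\<lambda>s. e s \<bullet> e s) has_real_derivative 2 * (e t \<bullet> v t)) (at t within {0..})"
      using has_real_derivative_inner[OF e_der[OF that] e_der[OF that]] by (simp add: inner_commute)
    moreover have "((\<lambda>s. z s \<bullet> z s) has_real_derivative 2 * (z t \<bullet> z' t)) (at t within {0..})"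
      using has_real_derivative_inner[OF z_der[OF that] z_der[OF that]] by (simp add: inner_commute)
    ultimately have "(W has_real_derivative 2 * (e t \<bullet> v t) / 2 + 2 * (z t \<bullet> z' t) / 2 + \<gamma> * Q' t)
        (at t within {0..})"
      unfolding W_def by (intro DERIV_add DERIV_cdivide DERIV_cmult Q_der[OF that])
    then show ?thesis by (simp add: W'_def)
  qed

  define \<alpha> where "\<alpha> = m - \<epsilon>1 * (h * K + 1) / 2"
  define \<beta> where "\<beta> = k1 - h - (h * K + 1) / (2 * \<epsilon>1) - k1 / (2 * \<epsilon>2)"
  define \<mu> where "\<mu> = min (4 * k2 / 5) (\<delta> / 3)"
  define \<kappa> where "\<kappa> = min (2 * \<alpha>) (min (2 * \<beta>) \<mu>)"
  have rates: "\<alpha> > 0" "\<beta> > 0"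
    unfolding \<alpha>_def \<beta>_def
    using gain_conditions_imp_positive_rates[OF \<open>h > 0\<close> \<open>K \<ge> 0\<close>] gains by auto
  then have "\<kappa> > 0" using gains \<open>\<delta> > 0\<close> by (simp add: \<kappa>_def \<mu>_def)
  have Q_nonneg: "Q t \<ge> 0" for t
    unfolding Q_def using observer_energy_bounds(1) gains by simp
  have W_dec: "W' t \<le> - \<kappa> * W t" for t
  proof -
    have "e t \<bullet> (z t - P (x t)) + z t \<bullet> z' t
        \<le> - \<alpha> * (norm (e t))\<^sup>2 - \<beta> * (norm (z t))\<^sup>2 + \<epsilon>2 * k1 / 2 * (norm (b t))\<^sup>2"
      unfolding \<alpha>_def \<beta>_def z'_def
      using mono[of "x t" xs] lip[of "x t" xs] J_bound[of "x t" "v t"] gains \<open>h > 0\<close> \<open>K \<ge> 0\<close>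
      by (intro seeking_energy_dissipation) (auto simp: zero e_def z_def)
    moreover have "z t - P (x t) = v t" by (simp add: z_def)
    moreover have "\<gamma> * Q' t \<le> \<gamma> * (- \<mu> * Q t - \<delta> / 2 * (norm (b t))\<^sup>2)"
      using observer_energy_dissipation[OF gains(2,3) refl refl, where a = "a t" and b = "b t"] \<open>\<gamma> > 0\<close>
      unfolding Q'_def Q_def \<mu>_def \<delta>_def by (intro mult_left_mono) auto
    moreover have "\<gamma> * (- \<mu> * Q t - \<delta> / 2 * (norm (b t))\<^sup>2)
        = - \<mu> * (\<gamma> * Q t) - \<epsilon>2 * k1 / 2 * (norm (b t))\<^sup>2"
      using \<open>\<delta> > 0\<close> by (simp add: \<gamma>_def field_simps)
    ultimately have "W' t \<le> - \<alpha> * (norm (e t))\<^sup>2 - \<beta> * (norm (z t))\<^sup>2 - \<mu> * (\<gamma> * Q t)"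
      unfolding W'_def by simp
    moreover have "\<kappa> / 2 * (norm (e t))\<^sup>2 \<le> \<alpha> * (norm (e t))\<^sup>2"
        "\<kappa> / 2 * (norm (z t))\<^sup>2 \<le> \<beta> * (norm (z t))\<^sup>2"
        "\<kappa> * (\<gamma> * Q t) \<le> \<mu> * (\<gamma> * Q t)"
      using Q_nonneg[of t] \<open>\<gamma> > 0\<close> by (intro mult_right_mono; simp add: \<kappa>_def min_def)+
    ultimately show ?thesis
      unfolding W_def power2_norm_eq_inner by (simp add: algebra_simps)
  qed
  have W_bound: "W t \<le> W 0 * exp (- \<kappa> * t)" if "t \<ge> 0" for t
    by (rule exponential_decay[OF W_der W_dec that])
  have "((\<lambda>t. W 0 * exp (- \<kappa> * t)) \<longlongrightarrow> W 0 * 0) at_top"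
  proof (intro tendsto_mult tendsto_const filterlim_compose[OF exp_at_bot])
    show "filterlim (\<lambda>t. - \<kappa> * t) at_bot at_top"
      using \<open>\<kappa> > 0\<close> by (intro filterlim_tendsto_neg_mult_at_bot[OF tendsto_const _ filterlim_ident]) simp
  qed
  from tendsto_real_sqrt[OF tendsto_mult_left[OF this, of 2]]
  have bound_lim: "((\<lambda>t. sqrt (2 * (W 0 * exp (- \<kappa> * t)))) \<longlongrightarrow> 0) at_top"
    by (simp only: mult_zero_right real_sqrt_zero)
  have vanish: "((\<lambda>t. norm (y t)) \<longlongrightarrow> 0) at_top"
    if y: "\<And>t. (norm (y t))\<^sup>2 \<le> 2 * W t" for y :: "real \<Rightarrow> 'a"
  proof (rule tendsto_sandwich[OF _ _ tendsto_const bound_lim])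
    have "norm (y t) \<le> sqrt (2 * (W 0 * exp (- \<kappa> * t)))" if "t \<ge> 0" for t
      using y[of t] W_bound[OF that] by (intro real_le_rsqrt) linarith
    then show "\<forall>\<^sub>F t in at_top. norm (y t) \<le> sqrt (2 * (W 0 * exp (- \<kappa> * t)))"
      unfolding eventually_at_top_linorder by blast
  qed simp
  have e_lim: "((\<lambda>t. norm (e t)) \<longlongrightarrow> 0) at_top" and z_lim: "((\<lambda>t. norm (z t)) \<longlongrightarrow> 0) at_top"
    using Q_nonneg \<open>\<gamma> > 0\<close> by (intro vanish; simp add: W_def power2_norm_eq_inner)+
  from e_lim show "((\<lambda>t. norm (x t - xs)) \<longlongrightarrow> 0) at_top" unfolding e_def .
  have lim: "((\<lambda>t. norm (z t) + K * norm (e t)) \<longlongrightarrow> 0) at_top"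
    using tendsto_add[OF z_lim tendsto_mult_left[OF e_lim, of K]] by simp
  have v_le: "norm (v t) \<le> norm (z t) + K * norm (e t)" for t
  proof -
    have "norm (P (x t)) \<le> K * norm (e t)" using lip[of "x t" xs] by (simp add: zero e_def)
    then show ?thesis using norm_triangle_ineq4[of "z t" "P (x t)"] by (simp add: z_def)
  qed
  show "((\<lambda>t. norm (v t)) \<longlongrightarrow> 0) at_top"
    by (rule tendsto_sandwich[OF _ _ tendsto_const lim]) (simp_all add: v_le)
qed

theorem theorem1:
  fixes f :: "'n::finite \<Rightarrow> real ^ 'n \<Rightarrow> real"
    and l :: "'n \<Rightarrow> real"
    and m h k1 k2 k3 \<epsilon>1 \<epsilon>2 :: real
  assumes "\<And>i. twice_continuously_differentiable (f i)"
    and "m > 0"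
    and "\<And>x y. (x - y) \<bullet> (pseudo_gradient f x - pseudo_gradient f y) \<ge> m * (norm (x - y))\<^sup>2"
    and "h > 0"
    and "bdd_above (range (\<lambda>x. matrix_norm (game_hessian f x)))"
    and "(SUP x. matrix_norm (game_hessian f x)) = h"
    and "\<And>i x y. \<bar>partial_deriv i (f i) x - partial_deriv i (f i) y\<bar> \<le> l i * norm (x - y)"
    and "k1 > 0" and "k2 > 0" and "k3 > 0"
    and "\<epsilon>1 > 0" and "\<epsilon>1 < 2 * m / (h * sqrt (real CARD('n)) * Max (range l) + 1)"
    and "\<epsilon>2 > 1 / 2"
    and "k1 > \<epsilon>2 * (2 * \<epsilon>1 * h + h * sqrt (real CARD('n)) * Max (range l) + 1)
               / (\<epsilon>1 * (2 * \<epsilon>2 - 1))"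
  shows "\<exists>xs. nash_equilibrium f xs \<and> (\<forall>y. nash_equilibrium f y \<longrightarrow> y = xs) \<and>
           (\<forall>x v xb vb. closed_loop_solution f k1 k2 k3 x v xb vb \<longrightarrow>
              ((\<lambda>t. norm (x t - xs)) \<longlongrightarrow> 0) at_top \<and> ((\<lambda>t. norm (v t)) \<longlongrightarrow> 0) at_top)"
proof -
  let ?P = "pseudo_gradient f"
  define K where "K = sqrt (real CARD('n)) * Max (range l)"
  have l_nonneg: "l i \<ge> 0" for i
  proof -
    have "0 \<le> l i * norm (axis i 1 - 0 :: real ^ 'n)"
      using assms(7)[of i "axis i 1" 0] by linarith
    then show ?thesis by simp
  qed
  have l_Max: "l i \<le> Max (range l)" for i by (rule Max_ge) auto
  have "K \<ge> 0"
    unfolding K_def using order_trans[OF l_nonneg l_Max] by simp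
  have lip: "norm (?P x - ?P y) \<le> K * norm (x - y)" for x y
  proof -
    have "\<bar>(?P x - ?P y) $ i\<bar> \<le> Max (range l) * norm (x - y)" for i
      using assms(7)[of i x y] mult_right_mono[OF l_Max[of i] norm_ge_zero[of "x - y"]]
      by (simp add: pseudo_gradient_def)
    from norm_le_sqrt_card_mult[OF this] show ?thesis by (simp add: K_def mult.assoc)
  qed
  have P_der: "(?P has_derivative (\<lambda>w. game_hessian f y *v w)) (at y)" for y
    by (rule pseudo_gradient_has_derivative) fact
  have hessian_bound: "norm (game_hessian f y *v w) \<le> h * norm w" for y w
  proof -
    have "norm (game_hessian f y *v w) \<le> matrix_norm (game_hessian f y) * norm w"
      unfolding matrix_norm_def by (rule onorm[OF matrix_vector_mul_bounded_linear])
    moreover have "matrix_norm (game_hessian f y) \<le> h"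
      using cSUP_upper[OF UNIV_I assms(5), of y] unfolding assms(6) .
    ultimately show ?thesis
      using mult_right_mono[of "matrix_norm (game_hessian f y)" h "norm w"] by simp
  qed
  have diff: "f i differentiable at y" for i y
    using assms(1)[of i] unfolding twice_continuously_differentiable_def differentiable_def by blast
  have "(x - y) \<bullet> (?P x - ?P y) \<ge> 0" for x y
    by (rule order_trans[OF _ assms(3)]) (use \<open>m > 0\<close> in simp)
  note nash_iff = nash_equilibrium_iff_pseudo_gradient_zero[OF diff this]
  obtain xs where zero: "?P xs = 0"
    using strongly_monotone_lipschitz_has_zero[OF assms(3,2) lip \<open>K \<ge> 0\<close>] by blast
  have unique: "y = xs" if "?P y = 0" for y
  proof -
    have "m * (norm (y - xs))\<^sup>2 \<le> 0" using assms(3)[of y xs] by (simp add: zero that)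
    then show ?thesis using \<open>m > 0\<close> by (simp add: mult_le_0_iff)
  qed
  have converges: "((\<lambda>t. norm (x t - xs)) \<longlongrightarrow> 0) at_top \<and> ((\<lambda>t. norm (v t)) \<longlongrightarrow> 0) at_top"
    if sol: "closed_loop_solution f k1 k2 k3 x v xb vb" for x v xb vb
  proof -
    note loop = sol[unfolded closed_loop_solution_def Let_def observer_control_def, rule_format]
    have x: "(x has_vector_derivative v t) (at t within {0..})" if "t \<ge> 0" for t
      by (rule has_vector_derivative_componentwise) (simp add: loop[OF that, simplified])
    have v: "(v has_vector_derivative - k1 *\<^sub>R ?P (x t) - k1 *\<^sub>R vb t) (at t within {0..})"
      if "t \<ge> 0" for t
      by (rule has_vector_derivative_componentwise)
        (simp add: pseudo_gradient_def loop[OF that, simplified])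
    have xb: "(xb has_vector_derivative - k2 *\<^sub>R (xb t - x t) + vb t) (at t within {0..})"
      if "t \<ge> 0" for t
      by (rule has_vector_derivative_componentwise) (simp add: loop[OF that, simplified])
    have vb: "(vb has_vector_derivative
        - k3 *\<^sub>R (xb t - x t) + (- k1 *\<^sub>R ?P (x t) - k1 *\<^sub>R vb t)) (at t within {0..})"
      if "t \<ge> 0" for t
      by (rule has_vector_derivative_componentwise)
        (simp add: pseudo_gradient_def loop[OF that, simplified])
    have \<epsilon>1: "\<epsilon>1 < 2 * m / (h * K + 1)"
      using assms(12) by (simp add: K_def mult.assoc)
    have k1: "k1 > \<epsilon>2 * (2 * \<epsilon>1 * h + h * K + 1) / (\<epsilon>1 * (2 * \<epsilon>2 - 1))"
      using assms(14) by (simp add: K_def mult.assoc)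
    note conv = observer_based_seeking_converges[OF P_der hessian_bound \<open>h > 0\<close> assms(3) lip \<open>K \<ge> 0\<close>
        zero assms(8-11,13) \<epsilon>1 k1 x v xb vb]
    show ?thesis using conv by blast
  qed
  show ?thesis
  proof (intro exI[of _ xs] conjI allI impI)
    show "nash_equilibrium f xs" using zero by (simp only: nash_iff)
    show "y = xs" if "nash_equilibrium f y" for y
      using that unfolding nash_iff by (rule unique)
  qed (use converges in blast)+
qed

end
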